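(* Let $H$ be a complex Hilbert space and let $A,B\in B(H)$ be self-adjoint operators such that $AB$ is normal. Then $|AB|=|A||B|$.
   Context: $B(H)$ denotes the algebra of bounded linear operators on $H$. For $T\in B(H)$, $|T|=\sqrt{T^*T}$ denotes the absolute value (modulus) of $T$, i.e. the unique positive square root of $T^*T$. An operator $T$ is normal if $TT^*=T^*T$. *)

theory Defs
  imports "HOL-Analysis.Analysis"
begin

text \<open>
  Complex Hilbert spaces are introduced on top of the real hierarchy: the complex structure extends
  the real scalar multiplication, and the real inner product is the real part of the complex one, so
  that norm, topology and completeness are those of the library.
  The complex inner product is linear in its first argument.  Its positive definiteness follows:
  \<open>cinner x x\<close> is real by conjugate symmetry, and its real part is \<open>inner x x\<close>.
\<close>

class complex_vector = real_vector +
  fixes scaleC :: "complex \<Rightarrow> 'a \<Rightarrow> 'a"  (infixr \<open>*\<^sub>C\<close> 75)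
  assumes scaleC_add_right: "c *\<^sub>C (x + y) = c *\<^sub>C x + c *\<^sub>C y"
    and scaleC_add_left: "(c + d) *\<^sub>C x = c *\<^sub>C x + d *\<^sub>C x"
    and scaleC_scaleC: "c *\<^sub>C d *\<^sub>C x = (c * d) *\<^sub>C x"
    and scaleC_one: "1 *\<^sub>C x = x"
    and scaleR_scaleC: "r *\<^sub>R x = complex_of_real r *\<^sub>C x"

class complex_inner = complex_vector + real_inner +
  fixes cinner :: "'a \<Rightarrow> 'a \<Rightarrow> complex"
  assumes cinner_commute: "cinner x y = cnj (cinner y x)"
    and cinner_add_left: "cinner (x + y) z = cinner x z + cinner y z"
    and cinner_scaleC_left: "cinner (c *\<^sub>C x) y = c * cinner x y"
    and inner_eq_Re_cinner: "inner x y = Re (cinner x y)"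

class complex_hilbert_space = complex_inner + banach

instantiation complex :: complex_hilbert_space
begin

definition scaleC_complex :: "complex \<Rightarrow> complex \<Rightarrow> complex"
  where "scaleC_complex c x = c * x"

definition cinner_complex :: "complex \<Rightarrow> complex \<Rightarrow> complex"
  where "cinner_complex x y = x * cnj y"

instance
  by standard
    (simp_all add: scaleC_complex_def cinner_complex_def inner_complex_def algebra_simps
      scaleR_conv_of_real)

end

text \<open>
  The library type of bounded operators only asks for real linearity, so the algebra \<open>B(H)\<close> is the
  set of its complex-linear elements.
\<close>

definition bounded_ops :: "('a::complex_hilbert_space \<Rightarrow>\<^sub>L 'a) set"
  where "bounded_ops = {T. \<forall>c x. blinfun_apply T (c *\<^sub>C x) = c *\<^sub>C blinfun_apply T x}"

text \<open>
  The adjoint and the positive square root are definite descriptions: they exist and are unique for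
  elements of \<open>B(H)\<close> and for positive operators, respectively, and are unspecified elsewhere.
\<close>

definition adj_op :: "('a::complex_hilbert_space \<Rightarrow>\<^sub>L 'a) \<Rightarrow> ('a \<Rightarrow>\<^sub>L 'a)"
  where "adj_op T = (THE S. S \<in> bounded_ops \<and>
    (\<forall>x y. cinner (blinfun_apply T x) y = cinner x (blinfun_apply S y)))"

definition selfadjoint_op :: "('a::complex_hilbert_space \<Rightarrow>\<^sub>L 'a) \<Rightarrow> bool"
  where "selfadjoint_op T \<longleftrightarrow> adj_op T = T"

definition normal_op :: "('a::complex_hilbert_space \<Rightarrow>\<^sub>L 'a) \<Rightarrow> bool"
  where "normal_op T \<longleftrightarrow> T o\<^sub>L adj_op T = adj_op T o\<^sub>L T"

definition positive_op :: "('a::complex_hilbert_space \<Rightarrow>\<^sub>L 'a) \<Rightarrow> bool"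
  where "positive_op T \<longleftrightarrow>
    T \<in> bounded_ops \<and> (\<forall>x. cinner (blinfun_apply T x) x \<in> \<real>\<^sub>\<ge>\<^sub>0)"

definition sqrt_op :: "('a::complex_hilbert_space \<Rightarrow>\<^sub>L 'a) \<Rightarrow> ('a \<Rightarrow>\<^sub>L 'a)"
  where "sqrt_op P = (THE S. positive_op S \<and> S o\<^sub>L S = P)"

definition abs_op :: "('a::complex_hilbert_space \<Rightarrow>\<^sub>L 'a) \<Rightarrow> ('a \<Rightarrow>\<^sub>L 'a)"
  where "abs_op T = sqrt_op (adj_op T o\<^sub>L T)"

end

theory Submission imports Defs begin

text \<open>
  Put \<open>N = AB\<close>, so that \<open>N\<^sup>* = BA\<close> and \<open>N A = ABA = A N\<^sup>*\<close>. If one can pass to adjoints on the \<open>N\<close>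
  side only, \<open>N\<^sup>* A = A N\<close>, then \<open>B A\<^sup>2 = A\<^sup>2 B\<close>, and by symmetry \<open>A B\<^sup>2 = B\<^sup>2 A\<close>. The square root
  of a positive operator commutes with whatever commutes with that operator, so \<open>|A|\<close> commutes with
  \<open>B\<close>, hence \<open>|B|\<close> with \<open>|A|\<close>. Therefore \<open>|A||B|\<close> is positive, its square is
  \<open>A\<^sup>2 B\<^sup>2 = B A\<^sup>2 B = (AB)\<^sup>* (AB)\<close>, and uniqueness of the positive root gives the claim.
  
  The passage to adjoints is an instance of the Fuglede--Putnam theorem. Its usual proof applies
  Liouville's theorem to operator exponentials; here, because \<open>A\<close> is self-adjoint, norm estimates
  suffice.
  
  \<^item> The relation \<open>N A = A N\<^sup>*\<close> and normality give \<open>\<parallel>N\<^sup>k A x\<parallel> \<le> \<parallel>A\<parallel> \<parallel>N\<^sup>k x\<parallel>\<close> for all \<open>k\<close>. Adding these up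
    with binomial weights bounds \<open>R\<^sup>n A R\<^sup>-\<^sup>n\<close> uniformly in \<open>n \<ge> 0\<close>, where \<open>R = 1 + e N\<^sup>* N\<close> is positive
    and, for small \<open>e > 0\<close>, invertible (\<open>intertwiner_powers_bounded\<close>).
  \<^item> If \<open>R\<^sup>n Y R\<^sup>-\<^sup>n\<close> is bounded in \<open>n\<close>, then already \<open>\<parallel>R Y R\<^sup>-\<^sup>1\<parallel> \<le> \<parallel>Y\<parallel>\<close>
    (\<open>norm_similar_le\<close>). This follows from \<open>\<parallel>R Y R\<^sup>-\<^sup>1\<parallel>\<^sup>2 \<le> \<parallel>Y\<parallel> \<parallel>R\<^sup>2 Y R\<^sup>-\<^sup>2\<parallel>\<close> by repeated doubling.
  \<^item> Applied to \<open>Y = A + \<i> t\<close> for all real \<open>t\<close>, this makes \<open>X = R A R\<^sup>-\<^sup>1\<close> satisfy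
    \<open>\<parallel>X + \<i> t\<parallel>\<^sup>2 \<le> \<parallel>A\<parallel>\<^sup>2 + t\<^sup>2\<close>, which forces the numerical range of \<open>X\<close> to be real. So \<open>X\<close> is
    self-adjoint, that is \<open>R A R\<^sup>-\<^sup>1 = R\<^sup>-\<^sup>1 A R\<close>, and \<open>A\<close> commutes with \<open>R\<^sup>2\<close>, with \<open>R\<close>, and with \<open>N\<^sup>* N\<close>.
  \<^item> Then \<open>D = N\<^sup>* A - A N\<close> is skew-adjoint with \<open>D\<^sup>2 = 0\<close>, so \<open>D = 0\<close> (\<open>intertwiner_adjoint\<close>).
\<close>

section \<open>The complex structure as an operator\<close>

text \<open>
  The real inner product and real-linear operators carry most of the argument; the complex structure
  enters only through multiplication by \<open>\<i>\<close>, taken as an operator so that complex linearity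
  becomes a commutation relation.
\<close>

definition i_op :: "'a::complex_hilbert_space \<Rightarrow>\<^sub>L 'a"
  where "i_op = Blinfun (\<lambda>x. \<i> *\<^sub>C x)"

lemma scaleC_i_i: "\<i> *\<^sub>C \<i> *\<^sub>C x = - (x::'a::complex_hilbert_space)"
proof -
  have "\<i> *\<^sub>C \<i> *\<^sub>C x = complex_of_real (-1) *\<^sub>C x"
    by (simp add: scaleC_scaleC)
  also have "\<dots> = - x"
    by (simp only: scaleR_scaleC[symmetric]) simp
  finally show ?thesis .
qed

lemma cinner_scaleC_right: "cinner x (c *\<^sub>C y) = cnj c * cinner x (y::'a::complex_hilbert_space)"
  by (metis cinner_commute cinner_scaleC_left complex_cnj_mult)

lemma inner_scaleC_i: "inner (\<i> *\<^sub>C x) (\<i> *\<^sub>C y) = inner x (y::'a::complex_hilbert_space)"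
  by (simp add: inner_eq_Re_cinner cinner_scaleC_left cinner_scaleC_right)

lemma i_op_apply [simp]: "blinfun_apply i_op x = \<i> *\<^sub>C (x::'a::complex_hilbert_space)"
proof -
  have "bounded_linear (\<lambda>x::'a. \<i> *\<^sub>C x)"
  proof (rule bounded_linear_intro[where K = 1])
    fix r and x y :: 'a
    show "\<i> *\<^sub>C (x + y) = \<i> *\<^sub>C x + \<i> *\<^sub>C y"
      by (rule scaleC_add_right)
    show "\<i> *\<^sub>C r *\<^sub>R x = r *\<^sub>R \<i> *\<^sub>C x"
      by (simp add: scaleR_scaleC scaleC_scaleC mult.commute)
    show "norm (\<i> *\<^sub>C x) \<le> norm x * 1"
      by (simp add: norm_eq_sqrt_inner inner_scaleC_i)
  qed
  then show ?thesis
    by (simp add: i_op_def bounded_linear_Blinfun_apply)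
qed

lemma inner_i_op_left: "inner (\<i> *\<^sub>C x) y = - inner x (\<i> *\<^sub>C (y::'a::complex_hilbert_space))"
  using inner_scaleC_i[of x "\<i> *\<^sub>C y"] by (simp add: scaleC_i_i)

lemma norm_scaleC_i: "norm (\<i> *\<^sub>C x) = norm (x::'a::complex_hilbert_space)"
  by (simp add: norm_eq_sqrt_inner inner_scaleC_i)

lemma Im_cinner: "Im (cinner x y) = inner x (\<i> *\<^sub>C (y::'a::complex_hilbert_space))"
  by (simp add: inner_eq_Re_cinner cinner_scaleC_right)

definition commute :: "('a::real_normed_vector \<Rightarrow>\<^sub>L 'a) \<Rightarrow> ('a \<Rightarrow>\<^sub>L 'a) \<Rightarrow> bool"
  where "commute S T \<longleftrightarrow> S o\<^sub>L T = T o\<^sub>L S"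

lemma commuteI:
  fixes S T :: "'a::real_normed_vector \<Rightarrow>\<^sub>L 'a"
  shows "(\<And>x. S (T x) = T (S x)) \<Longrightarrow> commute S T"
  by (auto simp: commute_def intro!: blinfun_eqI)

lemma commuteD:
  fixes S T :: "'a::real_normed_vector \<Rightarrow>\<^sub>L 'a"
  shows "commute S T \<Longrightarrow> S (T x) = T (S x)"
  by (metis commute_def blinfun_apply_blinfun_compose)

lemma commute_sym: "commute S T \<Longrightarrow> commute T S"
  by (simp add: commute_def)

lemma bounded_ops_iff:
  fixes T :: "'a::complex_hilbert_space \<Rightarrow>\<^sub>L 'a"
  shows "T \<in> bounded_ops \<longleftrightarrow> commute T i_op"
proof
  assume "T \<in> bounded_ops"
  then show "commute T i_op"
    by (intro commuteI) (simp add: bounded_ops_def)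
next
  assume *: "commute T i_op"
  have "T (c *\<^sub>C x) = c *\<^sub>C T x" for c x
  proof -
    have dec: "c *\<^sub>C y = Re c *\<^sub>R y + Im c *\<^sub>R \<i> *\<^sub>C y" for y :: 'a
    proof -
      have "c = complex_of_real (Re c) + complex_of_real (Im c) * \<i>"
        by (simp add: complex_eq_iff)
      then have "c *\<^sub>C y = (complex_of_real (Re c) + complex_of_real (Im c) * \<i>) *\<^sub>C y"
        by simp
      then show ?thesis
        by (simp only: scaleC_add_left scaleR_scaleC scaleC_scaleC)
    qed
    show ?thesis
      using commuteD[OF *] by (simp add: dec blinfun.add_right blinfun.scaleR_right)
  qed
  then show "T \<in> bounded_ops"
    by (simp add: bounded_ops_def)
qed

section \<open>Adjoints and positivity\<close>

text \<open>
  Adjointness for the real inner product. For complex-linear operators it agrees with adjointness for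
  the complex one, see \<open>adj_op_spec_iff\<close>, and as a relation it can be used
  before adjoints are known to exist.
\<close>

definition is_adjoint :: "('a::real_inner \<Rightarrow>\<^sub>L 'a) \<Rightarrow> ('a \<Rightarrow>\<^sub>L 'a) \<Rightarrow> bool"
  where "is_adjoint T S \<longleftrightarrow> (\<forall>x y. inner (T x) y = inner x (S y))"

lemma is_adjointD:
  fixes T S :: "'a::real_inner \<Rightarrow>\<^sub>L 'a"
  shows "is_adjoint T S \<Longrightarrow> inner (T x) y = inner x (S y)"
  by (simp add: is_adjoint_def)

lemma is_adjoint_unique: "is_adjoint T S \<Longrightarrow> is_adjoint T S' \<Longrightarrow> S = S'"
  by (intro blinfun_eqI) (metis is_adjoint_def vector_eq_ldot)

lemma is_adjoint_sym: "is_adjoint T S \<Longrightarrow> is_adjoint S T"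
  by (simp add: is_adjoint_def inner_commute)

lemma is_adjoint_compose: "is_adjoint T S \<Longrightarrow> is_adjoint T' S' \<Longrightarrow> is_adjoint (T o\<^sub>L T') (S' o\<^sub>L S)"
  by (simp add: is_adjoint_def)

text \<open>
  The representing vector minimises \<open>g x = \<parallel>x\<parallel>\<^sup>2 - 2 f x\<close>, which is bounded below since \<open>f\<close> is
  bounded. By the parallelogram law a minimising sequence is Cauchy, and the first-order condition at
  the minimum is \<open>f x = \<langle>x, v\<rangle>\<close>.
\<close>

lemma riesz_representation:
  fixes f :: "'a::{real_inner,banach} \<Rightarrow> real"
  assumes "bounded_linear f"
  obtains v where "\<And>x. f x = inner x v"
proof -
  interpret f: bounded_linear f by fact
  obtain K where K: "\<And>x. norm (f x) \<le> norm x * K"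
    using f.bounded by blast
  define g where "g x = inner x x - 2 * f x" for x
  have g_below: "- K\<^sup>2 \<le> g x" for x
  proof -
    have "0 \<le> (norm x - K)\<^sup>2" by simp
    moreover have "f x \<le> norm x * K" using K[of x] by simp
    ultimately show ?thesis
      by (simp add: g_def power2_eq_square algebra_simps flip: power2_norm_eq_inner)
  qed
  define m where "m = Inf (range g)"
  have bdd: "bdd_below (range g)"
    using g_below by (intro bdd_belowI2)
  have m_le: "m \<le> g x" for x
    unfolding m_def using bdd by (simp add: cInf_lower)
  have "\<exists>x. g x < m + 1 / real (Suc n)" for n
    using cInf_lessD[of "range g" "m + 1 / real (Suc n)"] by (auto simp: m_def)
  then obtain X where X: "\<And>n. g (X n) < m + 1 / real (Suc n)"
    by metis
  have par: "(norm (x - y))\<^sup>2 \<le> 2 * (g x - m) + 2 * (g y - m)" for x y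
  proof -
    have "(norm (x - y))\<^sup>2 = 2 * g x + 2 * g y - 4 * g ((1/2) *\<^sub>R (x + y))"
      by (simp add: g_def power2_norm_eq_inner inner_add inner_diff f.add f.scaleR
          inner_commute algebra_simps)
    with m_le[of "(1/2) *\<^sub>R (x + y)"] show ?thesis by simp
  qed
  have "Cauchy X"
  proof (rule metric_CauchyI)
    fix e :: real assume "0 < e"
    then obtain n0 where n0: "1 / real (Suc n0) < e\<^sup>2 / 4"
      using nat_approx_posE[of "e\<^sup>2/4"] by auto
    have "dist (X k) (X l) < e" if "n0 \<le> k" "n0 \<le> l" for k l
    proof -
      have "g (X j) - m < e\<^sup>2 / 4" if "n0 \<le> j" for j
      proof -
        have "1 / real (Suc j) \<le> 1 / real (Suc n0)"
          using that by (intro divide_left_mono) auto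
        with X[of j] n0 show ?thesis by linarith
      qed
      from this[OF that(1)] this[OF that(2)] have "(norm (X k - X l))\<^sup>2 < e\<^sup>2"
        using par[of "X k" "X l"] by argo
      then show ?thesis
        using \<open>0 < e\<close> by (simp add: dist_norm power2_less_imp_less)
    qed
    then show "\<exists>M. \<forall>k\<ge>M. \<forall>l\<ge>M. dist (X k) (X l) < e" by blast
  qed
  then obtain v where v: "X \<longlonglongrightarrow> v"
    using Cauchy_convergent convergent_def by blast
  have "(\<lambda>n. g (X n)) \<longlonglongrightarrow> g v"
    unfolding g_def by (intro tendsto_intros f.tendsto v)
  moreover have "(\<lambda>n. m + 1 / real (Suc n)) \<longlonglongrightarrow> m + 0"
    by (intro tendsto_intros LIMSEQ_Suc[OF lim_1_over_n])
  ultimately have "g v \<le> m + 0"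
    using X by (meson LIMSEQ_le less_imp_le)
  have "f x = inner x v" for x
  proof -
    define d where "d = inner x v - f x"
    have ineq: "0 \<le> 2 * t * d + t\<^sup>2 * inner x x" for t
    proof -
      have "g (v + t *\<^sub>R x) = g v + 2 * t * d + t\<^sup>2 * inner x x"
        by (simp add: g_def d_def inner_add f.add f.scaleR inner_commute algebra_simps
            power2_eq_square)
      with m_le[of "v + t *\<^sub>R x"] \<open>g v \<le> m + 0\<close> show ?thesis by simp
    qed
    define s where "s = 1 + inner x x"
    have s: "s > 0" by (simp add: s_def add_pos_nonneg)
    \<comment> \<open>The exact minimum over \<open>t\<close> is at \<open>- d / \<parallel>x\<parallel>\<^sup>2\<close>; the \<open>1\<close> in \<open>s\<close> avoids the case \<open>x = 0\<close>.\<close>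
    have "0 \<le> 2 * (- d / s) * d + (- d / s)\<^sup>2 * inner x x"
      by (rule ineq)
    also have "inner x x = s - 1"
      by (simp add: s_def)
    also have "2 * (- d / s) * d + (- d / s)\<^sup>2 * (s - 1) = (- d\<^sup>2 * (s + 1)) / s\<^sup>2"
      using s by (simp add: field_simps power2_eq_square)
    finally have "0 \<le> - d\<^sup>2 * (s + 1)"
      using s by (simp add: divide_le_0_iff zero_less_power2)
    then have "d = 0"
      using s by (smt (verit) mult_pos_pos zero_less_power2 mult_minus_left)
    then show ?thesis by (simp add: d_def)
  qed
  then show thesis by (rule that)
qed

lemma adjoint_exists:
  fixes T :: "'a::{real_inner,banach} \<Rightarrow>\<^sub>L 'a"
  obtains S where "is_adjoint T S"
proof -
  have "\<exists>v. \<forall>x. inner (T x) y = inner x v" for y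
  proof -
    have "bounded_linear (\<lambda>x. inner (T x) y)"
      by (intro bounded_linear_inner_left_comp blinfun.bounded_linear_right)
    from riesz_representation[OF this] show ?thesis by metis
  qed
  then obtain S where S: "\<And>x y. inner (T x) y = inner x (S y)"
    by metis
  have "bounded_linear S"
  proof (rule bounded_linear_intro[where K = "norm T"])
    fix r and x y
    show "S (x + y) = S x + S y"
      by (subst vector_eq_ldot[symmetric]) (simp add: inner_add_right flip: S)
    show "S (r *\<^sub>R x) = r *\<^sub>R S x"
      by (subst vector_eq_ldot[symmetric]) (simp flip: S)
    have "norm (S x) * norm (S x) = inner (T (S x)) x"
      by (simp add: S power2_norm_eq_inner flip: power2_eq_square)
    also have "\<dots> \<le> norm (T (S x)) * norm x"
      by (rule norm_cauchy_schwarz)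
    also have "\<dots> \<le> norm T * norm (S x) * norm x"
      by (intro mult_right_mono norm_blinfun) simp
    finally have "norm (S x) * norm (S x) \<le> norm (S x) * (norm x * norm T)"
      by (simp add: mult_ac)
    then show "norm (S x) \<le> norm x * norm T"
      by (cases "S x = 0") auto
  qed
  then have "is_adjoint T (Blinfun S)"
    by (simp add: is_adjoint_def bounded_linear_Blinfun_apply S)
  then show thesis by (rule that)
qed

text \<open>
  The real part of \<open>cinner x y\<close> is the real inner product and its imaginary part is \<open>\<langle>x, \<i> y\<rangle>\<close>.
  So the real relation yields the complex one as soon as \<open>S\<close> commutes with \<open>\<i>\<close>,
  and it does because \<open>T\<close> does and \<open>\<i>\<close> is skew-adjoint.
\<close>

lemma adj_op_spec_iff:
  fixes T S :: "'a::complex_hilbert_space \<Rightarrow>\<^sub>L 'a"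
  assumes "T \<in> bounded_ops"
  shows "S \<in> bounded_ops \<and> (\<forall>x y. cinner (T x) y = cinner x (S y)) \<longleftrightarrow> is_adjoint T S"
proof
  assume "S \<in> bounded_ops \<and> (\<forall>x y. cinner (T x) y = cinner x (S y))"
  then show "is_adjoint T S"
    by (simp add: is_adjoint_def inner_eq_Re_cinner)
next
  assume adj: "is_adjoint T S"
  have T: "T (\<i> *\<^sub>C x) = \<i> *\<^sub>C T x" for x
    using assms by (simp add: bounded_ops_def)
  have S: "S (\<i> *\<^sub>C x) = \<i> *\<^sub>C S x" for x
  proof (subst vector_eq_ldot[symmetric], rule allI)
    fix y
    have "inner y (S (\<i> *\<^sub>C x)) = - inner (T (\<i> *\<^sub>C y)) x"
      using inner_i_op_left[of "T y" x] by (simp add: T flip: is_adjointD[OF adj])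
    also have "\<dots> = inner y (\<i> *\<^sub>C S x)"
      using inner_i_op_left[of y "S x"] by (simp add: is_adjointD[OF adj])
    finally show "inner y (S (\<i> *\<^sub>C x)) = inner y (\<i> *\<^sub>C S x)" .
  qed
  have "cinner (T x) y = cinner x (S y)" for x y
    by (simp add: complex_eq_iff Im_cinner is_adjointD[OF adj] S flip: inner_eq_Re_cinner)
  then show "S \<in> bounded_ops \<and> (\<forall>x y. cinner (T x) y = cinner x (S y))"
    using S by (auto simp: bounded_ops_iff intro: commuteI)
qed

lemma adj_op_eqI:
  fixes T S :: "'a::complex_hilbert_space \<Rightarrow>\<^sub>L 'a"
  assumes "T \<in> bounded_ops" and "is_adjoint T S"
  shows "adj_op T = S"
  unfolding adj_op_def adj_op_spec_iff[OF assms(1)]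
  using assms(2) is_adjoint_unique by blast

text \<open>
  Existence of adjoints is essential: without it \<open>adj_op T = T\<close> would be a statement about an
  unspecified value.
\<close>

lemma selfadjoint_op_is_adjoint:
  fixes T :: "'a::complex_hilbert_space \<Rightarrow>\<^sub>L 'a"
  assumes "T \<in> bounded_ops" and "selfadjoint_op T"
  shows "is_adjoint T T"
  using assms adj_op_eqI adjoint_exists unfolding selfadjoint_op_def by metis

text \<open>
  An operator is symmetric iff its numerical range is real: \<open>\<langle>T x, \<i> x\<rangle>\<close> is the imaginary part of
  \<open>cinner (T x) x\<close>, and its vanishing polarises.
\<close>

lemma symmetric_iff:
  fixes T :: "'a::complex_hilbert_space \<Rightarrow>\<^sub>L 'a"
  assumes "T \<in> bounded_ops"
  shows "is_adjoint T T \<longleftrightarrow> (\<forall>x. inner (T x) (\<i> *\<^sub>C x) = 0)"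
proof
  have T: "T (\<i> *\<^sub>C x) = \<i> *\<^sub>C T x" for x
    using assms by (simp add: bounded_ops_def)
  assume adj: "is_adjoint T T"
  show "\<forall>x. inner (T x) (\<i> *\<^sub>C x) = 0"
  proof
    fix x
    have "inner (T x) (\<i> *\<^sub>C x) = inner x (\<i> *\<^sub>C T x)"
      by (simp add: is_adjointD[OF adj] T)
    then show "inner (T x) (\<i> *\<^sub>C x) = 0"
      using inner_i_op_left[of x "T x"] by (simp add: inner_commute)
  qed
next
  have T: "T (\<i> *\<^sub>C x) = \<i> *\<^sub>C T x" for x
    using assms by (simp add: bounded_ops_def)
  assume zero: "\<forall>x. inner (T x) (\<i> *\<^sub>C x) = 0"
  have "inner (T x) (\<i> *\<^sub>C y) = inner x (T (\<i> *\<^sub>C y))" for x y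
  proof -
    have "inner (T (x + y)) (\<i> *\<^sub>C (x + y)) = 0"
      using zero by blast
    then have "inner (T x) (\<i> *\<^sub>C y) = - inner (T y) (\<i> *\<^sub>C x)"
      using zero by (simp add: blinfun.add_right scaleC_add_right inner_add)
    also have "\<dots> = inner x (T (\<i> *\<^sub>C y))"
      using inner_i_op_left[of "T y" x] by (simp add: T inner_commute)
    finally show ?thesis .
  qed
  from this[of _ "- (\<i> *\<^sub>C _)"] have "inner (T x) y = inner x (T y)" for x y
    by (metis scaleC_i_i minus_minus)
  then show "is_adjoint T T"
    by (simp add: is_adjoint_def)
qed

lemma positive_op_iff:
  fixes P :: "'a::complex_hilbert_space \<Rightarrow>\<^sub>L 'a"
  shows "positive_op P \<longleftrightarrow> P \<in> bounded_ops \<and> is_adjoint P P \<and> (\<forall>x. 0 \<le> inner (P x) x)"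
proof (cases "P \<in> bounded_ops")
  case True
  then show ?thesis
    by (auto simp: positive_op_def symmetric_iff complex_nonneg_Reals_iff Im_cinner
        inner_eq_Re_cinner)
next
  case False
  then show ?thesis by (simp add: positive_op_def)
qed

section \<open>Square roots of positive operators\<close>


lemma compose_assoc:
  fixes R S T :: "'a::real_normed_vector \<Rightarrow>\<^sub>L 'a"
  shows "(R o\<^sub>L S) o\<^sub>L T = R o\<^sub>L (S o\<^sub>L T)"
  by (rule blinfun_eqI) simp

text \<open>
  Expand \<open>\<langle>P y, y\<rangle> \<ge> 0\<close> at \<open>y = c x - P x\<close> with \<open>c = \<parallel>P\<parallel>\<close>.
\<close>

lemma norm_apply_sq_le_inner:
  fixes P :: "'a::real_inner \<Rightarrow>\<^sub>L 'a"
  assumes sym: "is_adjoint P P" and pos: "\<And>x. 0 \<le> inner (P x) x"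
  shows "(norm (P x))\<^sup>2 \<le> norm P * inner (P x) x"
proof (cases "norm P = 0")
  case True
  then show ?thesis by simp
next
  case False
  define c where "c = norm P"
  have c: "c > 0" using False by (simp add: c_def)
  have "inner (P (P x)) (P x) \<le> norm (P (P x)) * norm (P x)"
    by (rule norm_cauchy_schwarz)
  also have "\<dots> \<le> (c * norm (P x)) * norm (P x)"
    unfolding c_def by (intro mult_right_mono norm_blinfun) simp
  finally have le: "inner (P (P x)) (P x) \<le> c * (norm (P x))\<^sup>2"
    by (simp add: power2_eq_square)
  have "0 \<le> inner (P (c *\<^sub>R x - P x)) (c *\<^sub>R x - P x)"
    by (rule pos)
  also have "\<dots> = c\<^sup>2 * inner (P x) x - 2 * c * inner (P x) (P x) + inner (P (P x)) (P x)"
    using is_adjointD[OF sym, of "P x" x]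
    by (simp add: blinfun.diff_right blinfun.scaleR_right inner_diff algebra_simps
        power2_eq_square)
  finally have "c * (norm (P x))\<^sup>2 \<le> c * (c * inner (P x) x)"
    using le unfolding power2_norm_eq_inner by (simp add: power2_eq_square algebra_simps)
  then show ?thesis
    using c by (simp add: c_def)
qed

lemma positive_apply_eq_0:
  fixes P :: "'a::real_inner \<Rightarrow>\<^sub>L 'a"
  assumes "is_adjoint P P" and "\<And>x. 0 \<le> inner (P x) x" and "inner (P x) x = 0"
  shows "P x = 0"
  using norm_apply_sq_le_inner[OF assms(1,2), of x] assms(3) by simp

text \<open>
  With \<open>y = (S - T) x\<close>, commutation gives \<open>(S + T) y = (S\<^sup>2 - T\<^sup>2) x = 0\<close>. Hence
  \<open>\<langle>S y, y\<rangle> + \<langle>T y, y\<rangle> = 0\<close>, so \<open>S y = T y = 0\<close> by positivity, and \<open>\<parallel>y\<parallel>\<^sup>2 = \<langle>x, (S - T) y\<rangle> = 0\<close>.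
\<close>

lemma positive_root_unique_commuting:
  fixes S T :: "'a::real_inner \<Rightarrow>\<^sub>L 'a"
  assumes S: "is_adjoint S S" "\<And>x. 0 \<le> inner (S x) x"
    and T: "is_adjoint T T" "\<And>x. 0 \<le> inner (T x) x"
    and "commute S T" and "S o\<^sub>L S = T o\<^sub>L T"
  shows "S = T"
proof (rule blinfun_eqI)
  fix x
  define y where "y = S x - T x"
  have ST: "S (T z) = T (S z)" and SS: "S (S z) = T (T z)" for z
    using commuteD[OF assms(5)] arg_cong[OF assms(6), of "\<lambda>U. U z"] by auto
  have "S y + T y = 0"
    by (simp add: y_def blinfun.diff_right ST SS)
  then have "inner (S y) y + inner (T y) y = 0"
    by (metis inner_add_left inner_zero_left)
  then have "inner (S y) y = 0" "inner (T y) y = 0"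
    using S(2)[of y] T(2)[of y] by linarith+
  then have "S y = 0" "T y = 0"
    using positive_apply_eq_0 S T by blast+
  have "inner y y = inner (S x) y - inner (T x) y"
    by (simp add: y_def inner_diff_left)
  also have "\<dots> = 0"
    by (simp add: is_adjointD[OF S(1)] is_adjointD[OF T(1)] \<open>S y = 0\<close> \<open>T y = 0\<close>)
  finally show "S x = T x"
    by (simp add: y_def)
qed

lemma blinfun_tendsto_apply:
  assumes "X \<longlonglongrightarrow> L"
  shows "(\<lambda>n. blinfun_apply (X n) x) \<longlonglongrightarrow> L x"
  by (intro tendsto_intros assms)

text \<open>
  The scalar case of the iteration in \<open>positive_root_exists_contraction\<close>, which it majorises.
\<close>

lemma scalar_root_iteration:
  defines "x \<equiv> \<lambda>n. ((\<lambda>t::real. (1 + t\<^sup>2) / 2) ^^ n) 0"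
  shows "0 \<le> x n" "x n \<le> 1" "x n \<le> x (Suc n)" "Cauchy x"
proof -
  have rec: "x (Suc n) = (1 + (x n)\<^sup>2) / 2" for n
    by (simp add: x_def)
  show nn: "0 \<le> x n" for n
    by (cases n) (simp_all add: x_def)
  show le1: "x n \<le> 1" for n
  proof (induction n)
    case 0
    show ?case by (simp add: x_def)
  next
    case (Suc n)
    then show ?case
      using nn[of n] by (simp add: rec power_le_one)
  qed
  show inc: "x n \<le> x (Suc n)" for n
    using zero_le_power2[of "x n - 1"] by (simp add: rec power2_eq_square algebra_simps)
  have "incseq x"
    using inc by (rule incseq_SucI)
  then show "Cauchy x"
    using incseq_convergent[of x 1] le1 LIMSEQ_imp_Cauchy by blast
qed

text \<open>
  Write \<open>P = 1 - Q\<close> with \<open>\<parallel>Q\<parallel> \<le> 1\<close>. A root of the form \<open>1 - L\<close> amounts to a fixed point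
  \<open>L = (Q + L\<^sup>2) / 2\<close>, found by iterating from \<open>0\<close>. The iterates are polynomials in \<open>Q\<close> with
  nonnegative coefficients, so their increments are bounded in norm by those of the same iteration
  for \<open>Q = 1\<close>, which is bounded and monotone; this gives convergence in norm even when \<open>\<parallel>Q\<parallel> = 1\<close>.
  Everything that commutes with \<open>P\<close> commutes with the iterates, hence with the limit.
\<close>

lemma positive_root_exists_contraction:
  fixes P :: "'a::{real_inner,banach} \<Rightarrow>\<^sub>L 'a"
  assumes sym: "is_adjoint P P" and pos: "\<And>x. 0 \<le> inner (P x) x" and le1: "norm P \<le> 1"
  obtains S where "is_adjoint S S" and "\<And>x. 0 \<le> inner (S x) x" and "S o\<^sub>L S = P"
    and "\<And>T. commute P T \<Longrightarrow> commute S T"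
proof -
  define Q where "Q = id_blinfun - P"
  have Qx: "Q x = x - P x" for x
    by (simp add: Q_def blinfun.diff_left)
  have normQ: "norm Q \<le> 1"
  proof (rule norm_blinfun_bound)
    fix x
    have "(norm (P x))\<^sup>2 \<le> norm P * inner (P x) x"
      by (rule norm_apply_sq_le_inner[OF sym pos])
    also have "\<dots> \<le> 1 * inner (P x) x"
      by (intro mult_right_mono le1 pos)
    finally have "inner (P x) (P x) \<le> inner (P x) x"
      by (simp add: power2_norm_eq_inner)
    then have "(norm (Q x))\<^sup>2 \<le> (norm x)\<^sup>2"
      unfolding power2_norm_eq_inner Qx inner_diff using pos[of x] inner_commute[of x "P x"]
      by linarith
    then show "norm (Q x) \<le> 1 * norm x"
      by (auto intro: power2_le_imp_le)
  qed simp
  have symQ: "is_adjoint Q Q"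
    using sym by (simp add: is_adjoint_def Qx inner_diff)
  have commQ: "commute Q T" if "commute P T" for T
    using commuteD[OF that] by (intro commuteI) (simp add: Qx blinfun.diff_right)
  define X where "X n = ((\<lambda>Y. (1/2) *\<^sub>R (Q + (Y o\<^sub>L Y))) ^^ n) 0" for n
  define x where "x n = ((\<lambda>t::real. (1 + t\<^sup>2) / 2) ^^ n) 0" for n
  have X0: "X 0 = 0" and XSuc: "X (Suc n) = (1/2) *\<^sub>R (Q + (X n o\<^sub>L X n))" for n
    by (simp_all add: X_def)
  have x0: "x 0 = 0" and xSuc: "x (Suc n) = (1 + (x n)\<^sup>2) / 2" for n
    by (simp_all add: x_def)
  have x: "0 \<le> x n" "x n \<le> 1" "x n \<le> x (Suc n)" "Cauchy x" for n
    using scalar_root_iteration unfolding x_def by auto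
  have XSuc_apply: "X (Suc n) z = (1/2) *\<^sub>R (Q z + X n (X n z))" for n z
    by (simp add: XSuc blinfun.add_left blinfun.scaleR_left)
  have commX: "commute (X n) T" if "commute P T" for n T
  proof (induction n)
    case 0
    show ?case by (simp add: X0 commute_def)
  next
    case (Suc n)
    show ?case
      using commuteD[OF commQ[OF that]] commuteD[OF Suc]
      by (intro commuteI) (simp add: XSuc_apply blinfun.add_right blinfun.scaleR_right)
  qed
  have symX: "is_adjoint (X n) (X n)" for n
  proof (induction n)
    case 0
    show ?case by (simp add: X0 is_adjoint_def)
  next
    case (Suc n)
    show ?case
      by (simp add: is_adjoint_def XSuc_apply inner_add is_adjointD[OF symQ] is_adjointD[OF Suc])
  qed
  have XX: "commute (X m) (X n)" for m n
  proof -
    have "commute (X n) P"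
      by (rule commX) (simp add: commute_def)
    then show ?thesis
      by (rule commX[OF commute_sym])
  qed
  have normX: "norm (X n) \<le> x n" for n
  proof (induction n)
    case 0
    show ?case by (simp add: X0 x0)
  next
    case (Suc n)
    have "norm (X n o\<^sub>L X n) \<le> norm (X n) * norm (X n)"
      by (rule norm_blinfun_compose)
    also have "\<dots> \<le> x n * x n"
      by (intro mult_mono Suc x) simp
    finally have "norm (Q + (X n o\<^sub>L X n)) \<le> 1 + x n * x n"
      using normQ norm_triangle_ineq[of Q "X n o\<^sub>L X n"] by linarith
    then show ?case
      by (simp add: XSuc xSuc power2_eq_square)
  qed
  have factor: "(1/2) *\<^sub>R (Q + (U o\<^sub>L U)) - (1/2) *\<^sub>R (Q + (V o\<^sub>L V))
      = (1/2) *\<^sub>R ((U + V) o\<^sub>L (U - V))" if "commute U V" for U V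
    by (rule blinfun_eqI)
      (simp add: blinfun.bilinear_simps commuteD[OF that] scaleR_diff_right scaleR_add_right)
  have step: "norm (X (Suc n) - X n) \<le> x (Suc n) - x n" for n
  proof (induction n)
    case 0
    show ?case using normX[of 1] by (simp add: X0 x0)
  next
    case (Suc n)
    have "X (Suc (Suc n)) - X (Suc n)
        = (1/2) *\<^sub>R ((X (Suc n) + X n) o\<^sub>L (X (Suc n) - X n))"
      using factor[OF XX[of "Suc n" n]]
      by (simp only: XSuc[of "Suc n", symmetric] XSuc[of n, symmetric])
    also have "norm \<dots> = (1/2) * norm ((X (Suc n) + X n) o\<^sub>L (X (Suc n) - X n))"
      by simp
    also have "\<dots> \<le> (1/2) * (norm (X (Suc n) + X n) * norm (X (Suc n) - X n))"
      by (intro mult_left_mono norm_blinfun_compose) simp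
    also have "\<dots> \<le> (1/2) * ((x (Suc n) + x n) * (x (Suc n) - x n))"
      using normX[of n] normX[of "Suc n"] norm_triangle_ineq[of "X (Suc n)" "X n"] Suc x
      by (intro mult_left_mono mult_mono) simp_all
    also have "\<dots> = x (Suc (Suc n)) - x (Suc n)"
      by (simp add: xSuc[of "Suc n"]) (simp add: xSuc[of n] power2_eq_square field_simps)
    finally show ?case .
  qed
  have dist_le: "norm (X n - X m) \<le> x n - x m" if "m \<le> n" for m n
    using that
  proof (induction n rule: dec_induct)
    case base
    show ?case by simp
  next
    case (step n)
    then show ?case
      using \<open>norm (X (Suc n) - X n) \<le> x (Suc n) - x n\<close>
        norm_triangle_ineq[of "X (Suc n) - X n" "X n - X m"] by simp
  qed
  have dist: "dist (X m) (X n) \<le> dist (x m) (x n)" for m n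
    using dist_le[of m n] dist_le[of n m]
    by (cases "m \<le> n") (auto simp: dist_norm norm_minus_commute)
  have "Cauchy X"
    unfolding Cauchy_def
  proof (intro allI impI)
    fix e :: real assume "0 < e"
    then obtain M where "\<forall>m\<ge>M. \<forall>n\<ge>M. dist (x m) (x n) < e"
      using \<open>Cauchy x\<close> unfolding Cauchy_def by blast
    then show "\<exists>M. \<forall>m\<ge>M. \<forall>n\<ge>M. dist (X m) (X n) < e"
      using le_less_trans[OF dist] by blast
  qed
  then obtain L where L: "X \<longlonglongrightarrow> L"
    using Cauchy_convergent convergent_def by blast
  note Lx = blinfun_tendsto_apply[OF L]
  have "(\<lambda>n. X (Suc n)) \<longlonglongrightarrow> (1/2) *\<^sub>R (Q + (L o\<^sub>L L))"
    unfolding XSuc by (intro tendsto_intros L)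
  then have fixpoint: "L = (1/2) *\<^sub>R (Q + (L o\<^sub>L L))"
    using LIMSEQ_Suc[OF L] LIMSEQ_unique by blast
  have fix_apply: "2 *\<^sub>R L z = z - P z + L (L z)" for z
    by (subst fixpoint) (simp add: blinfun.scaleR_left blinfun.add_left Qx)
  have normL: "norm L \<le> 1"
  proof (rule LIMSEQ_le_const2[OF tendsto_norm[OF L]])
    show "\<exists>N. \<forall>n\<ge>N. norm (X n) \<le> 1"
      using order_trans[OF normX x(2)] by blast
  qed
  have symL: "is_adjoint L L"
    unfolding is_adjoint_def
  proof (intro allI)
    fix y z
    have "(\<lambda>n. inner (X n y) z) \<longlonglongrightarrow> inner (L y) z" "(\<lambda>n. inner y (X n z)) \<longlonglongrightarrow> inner y (L z)"
      by (intro tendsto_intros Lx)+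
    then show "inner (L y) z = inner y (L z)"
      using LIMSEQ_unique by (simp add: is_adjointD[OF symX])
  qed
  have commL: "commute L T" if "commute P T" for T
  proof (rule commuteI)
    fix z
    have "(\<lambda>n. T (X n z)) \<longlonglongrightarrow> T (L z)"
      by (intro blinfun.tendsto tendsto_const Lx)
    then show "L (T z) = T (L z)"
      using LIMSEQ_unique[OF Lx[of "T z"]] by (simp add: commuteD[OF commX[OF that]])
  qed
  define S where "S = id_blinfun - L"
  have Sx: "S z = z - L z" for z
    by (simp add: S_def blinfun.diff_left)
  show thesis
  proof (rule that)
    show "is_adjoint S S"
      using symL by (simp add: is_adjoint_def Sx inner_diff)
    show "0 \<le> inner (S z) z" for z
    proof -
      have "inner (L z) z \<le> norm (L z) * norm z"
        by (rule norm_cauchy_schwarz)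
      also have "\<dots> \<le> (norm L * norm z) * norm z"
        by (intro mult_right_mono norm_blinfun) simp
      also have "\<dots> \<le> (1 * norm z) * norm z"
        by (intro mult_right_mono normL) simp_all
      finally show ?thesis
        by (simp add: Sx inner_diff flip: power2_eq_square power2_norm_eq_inner)
    qed
    show "S o\<^sub>L S = P"
    proof (rule blinfun_eqI)
      fix z
      have "(S o\<^sub>L S) z = z - 2 *\<^sub>R L z + L (L z)"
        by (simp add: Sx blinfun.diff_right scaleR_2)
      then show "(S o\<^sub>L S) z = P z"
        by (simp add: fix_apply)
    qed
    show "commute S T" if "commute P T" for T
      using commuteD[OF commL[OF that]] by (intro commuteI) (simp add: Sx blinfun.diff_right)
  qed
qed

lemma positive_root_exists:
  fixes P :: "'a::{real_inner,banach} \<Rightarrow>\<^sub>L 'a"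
  assumes sym: "is_adjoint P P" and pos: "\<And>x. 0 \<le> inner (P x) x"
  obtains S where "is_adjoint S S" and "\<And>x. 0 \<le> inner (S x) x" and "S o\<^sub>L S = P"
    and "\<And>T. commute P T \<Longrightarrow> commute S T"
proof -
  define c where "c = 1 + norm P"
  have c: "c > 0" by (simp add: c_def add_pos_nonneg)
  define P' where "P' = (1/c) *\<^sub>R P"
  have P': "P' x = (1/c) *\<^sub>R P x" for x
    by (simp add: P'_def blinfun.scaleR_left)
  obtain S where S: "is_adjoint S S" "\<And>x. 0 \<le> inner (S x) x" "S o\<^sub>L S = P'"
    "\<And>T. commute P' T \<Longrightarrow> commute S T"
  proof (rule positive_root_exists_contraction)
    show "is_adjoint P' P'"
      using sym by (simp add: is_adjoint_def P')
    show "0 \<le> inner (P' x) x" for x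
      using pos c by (simp add: P')
    show "norm P' \<le> 1"
      using c by (simp add: P'_def c_def)
  qed (rule that)
  define R where "R = sqrt c *\<^sub>R S"
  have R: "R x = sqrt c *\<^sub>R S x" for x
    by (simp add: R_def blinfun.scaleR_left)
  show thesis
  proof (rule that)
    show "is_adjoint R R"
      using S(1) by (simp add: is_adjoint_def R)
    show "0 \<le> inner (R x) x" for x
      using S(2) c by (simp add: R)
    show "R o\<^sub>L R = P"
    proof (rule blinfun_eqI)
      fix x
      have "S (S x) = P' x"
        using arg_cong[OF S(3), of "\<lambda>U. U x"] by simp
      then show "(R o\<^sub>L R) x = P x"
        using c by (simp add: R blinfun.scaleR_right P')
    qed
    show "commute R T" if "commute P T" for T
    proof -
      have "commute P' T"
        using commuteD[OF that] by (intro commuteI) (simp add: P' blinfun.scaleR_right)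
      from commuteD[OF S(4)[OF this]] show ?thesis
        by (intro commuteI) (simp add: R blinfun.scaleR_right)
    qed
  qed
qed

text \<open>
  The root constructed for \<open>S\<^sup>2\<close> has this property by construction; it commutes with \<open>S\<close> because
  \<open>S\<close> commutes with \<open>S\<^sup>2\<close>, so it is equal to \<open>S\<close>.
\<close>

lemma commute_positive_root:
  fixes S :: "'a::{real_inner,banach} \<Rightarrow>\<^sub>L 'a"
  assumes S: "is_adjoint S S" "\<And>x. 0 \<le> inner (S x) x" and "commute (S o\<^sub>L S) T"
  shows "commute S T"
proof -
  have sym: "is_adjoint (S o\<^sub>L S) (S o\<^sub>L S)"
    by (rule is_adjoint_compose[OF S(1) S(1)])
  have pos: "0 \<le> inner ((S o\<^sub>L S) x) x" for x
    using inner_ge_zero[of "S x"] by (simp add: is_adjointD[OF S(1)] del: inner_ge_zero)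
  obtain S' where S': "is_adjoint S' S'" "\<And>x. 0 \<le> inner (S' x) x" "S' o\<^sub>L S' = S o\<^sub>L S"
    "\<And>T. commute (S o\<^sub>L S) T \<Longrightarrow> commute S' T"
    using positive_root_exists[OF sym pos] by blast
  have "commute S' S"
    by (rule S'(4)) (simp add: commute_def compose_assoc)
  then have "S' = S"
    by (rule positive_root_unique_commuting[OF S'(1,2) S(1,2) _ S'(3)])
  with S'(4)[OF assms(3)] show ?thesis by simp
qed

text \<open>
  With a root \<open>R\<close> of \<open>S\<close> that commutes with \<open>T\<close>, \<open>\<langle>S T x, x\<rangle> = \<langle>T (R x), R x\<rangle>\<close>.
\<close>

lemma positive_compose_commuting:
  fixes S T :: "'a::{real_inner,banach} \<Rightarrow>\<^sub>L 'a"
  assumes S: "is_adjoint S S" "\<And>x. 0 \<le> inner (S x) x"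
    and T: "is_adjoint T T" "\<And>x. 0 \<le> inner (T x) x" and "commute S T"
  shows "0 \<le> inner ((S o\<^sub>L T) x) x"
proof -
  obtain R where R: "is_adjoint R R" "R o\<^sub>L R = S" "commute R T"
    using positive_root_exists[OF S] assms(5) by metis
  have "inner ((S o\<^sub>L T) x) x = inner (R (T x)) (R x)"
    unfolding R(2)[symmetric] using is_adjointD[OF R(1), of "R (T x)" x] by simp
  then have "inner ((S o\<^sub>L T) x) x = inner (T (R x)) (R x)"
    by (simp add: commuteD[OF R(3)])
  with T(2) show ?thesis by simp
qed

lemma sqrt_op_eqI:
  fixes P S :: "'a::complex_hilbert_space \<Rightarrow>\<^sub>L 'a"
  assumes "positive_op S" and "S o\<^sub>L S = P"
  shows "sqrt_op P = S"
  unfolding sqrt_op_def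
proof (rule the_equality)
  show "positive_op S \<and> S o\<^sub>L S = P"
    using assms by simp
next
  fix S' assume S': "positive_op S' \<and> S' o\<^sub>L S' = P"
  have pos: "is_adjoint S S" "\<And>x. 0 \<le> inner (S x) x" "is_adjoint S' S'" "\<And>x. 0 \<le> inner (S' x) x"
    using assms(1) S' by (auto simp: positive_op_iff)
  have sq: "S o\<^sub>L S = S' o\<^sub>L S'"
    using assms(2) S' by simp
  have "commute (S o\<^sub>L S) S'"
    unfolding sq by (simp add: commute_def compose_assoc)
  then have "commute S S'"
    by (rule commute_positive_root[OF pos(1,2)])
  then show "S' = S"
    using positive_root_unique_commuting[OF pos _ sq] by simp
qed

section \<open>Norms of similar operators\<close>


lemma le_if_power_two_power_le:
  fixes a b c :: real
  assumes "0 \<le> a" and "0 \<le> b" and le: "\<And>k. a ^ (2 ^ k) \<le> c * b ^ (2 ^ k)"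
  shows "a \<le> b"
proof (rule ccontr)
  assume "\<not> a \<le> b"
  then have ab: "b < a" by simp
  show False
  proof (cases "b = 0")
    case True
    with le[of 0] ab show False by simp
  next
    case False
    with \<open>0 \<le> b\<close> have b: "0 < b" by simp
    then have t: "1 < a / b" using ab by simp
    then obtain n where n: "c < (a / b) ^ n"
      using real_arch_pow by blast
    also have "\<dots> \<le> (a / b) ^ (2 ^ n)"
      using t by (intro power_increasing) (auto intro: less_imp_le)
    also have "\<dots> \<le> c"
      using le[of n] b by (simp add: power_divide divide_le_eq)
    finally show False by simp
  qed
qed

lemma norm_sq_le_norm_adjoint_compose:
  fixes T S :: "'a::real_inner \<Rightarrow>\<^sub>L 'a"
  assumes "is_adjoint T S"
  shows "(norm T)\<^sup>2 \<le> norm (S o\<^sub>L T)"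
proof -
  have "norm T \<le> sqrt (norm (S o\<^sub>L T))"
  proof (rule norm_blinfun_bound)
    fix x
    have "(norm (T x))\<^sup>2 = inner x ((S o\<^sub>L T) x)"
      by (simp add: power2_norm_eq_inner is_adjointD[OF assms])
    also have "\<dots> \<le> norm x * norm ((S o\<^sub>L T) x)"
      by (rule norm_cauchy_schwarz)
    also have "\<dots> \<le> norm x * (norm (S o\<^sub>L T) * norm x)"
      by (intro mult_left_mono norm_blinfun) simp
    also have "\<dots> = (sqrt (norm (S o\<^sub>L T)) * norm x)\<^sup>2"
      by (simp add: power_mult_distrib power2_eq_square)
    finally show "norm (T x) \<le> sqrt (norm (S o\<^sub>L T)) * norm x"
      by (rule power2_le_imp_le) simp
  qed simp
  then show ?thesis
    by (metis norm_ge_zero power_mono real_sqrt_pow2)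
qed

lemma norm_adjoint_le:
  fixes T S :: "'a::real_inner \<Rightarrow>\<^sub>L 'a"
  assumes "is_adjoint T S"
  shows "norm S \<le> norm T"
proof -
  have "(norm S)\<^sup>2 \<le> norm (T o\<^sub>L S)"
    by (rule norm_sq_le_norm_adjoint_compose[OF is_adjoint_sym[OF assms]])
  also have "\<dots> \<le> norm T * norm S"
    by (rule norm_blinfun_compose)
  finally show ?thesis
    by (cases "norm S = 0") (auto simp: power2_eq_square)
qed

text \<open>
  A symmetric operator satisfies \<open>\<parallel>H\<^sup>m\<parallel> = \<parallel>H\<parallel>\<^sup>m\<close> for \<open>m = 2\<^sup>k\<close>, while the similar operator \<open>L\<close> has
  \<open>H\<^sup>m = V L\<^sup>m U\<close>. So \<open>\<parallel>H\<parallel>\<^sup>m \<le> \<parallel>V\<parallel> \<parallel>U\<parallel> \<parallel>L\<parallel>\<^sup>m\<close>, and the constant disappears as \<open>m\<close> grows. This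
  replaces the spectral radius.
\<close>

lemma norm_symmetric_similar_le:
  fixes H L U V :: "'a::real_inner \<Rightarrow>\<^sub>L 'a"
  assumes "is_adjoint H H" and "H = V o\<^sub>L (L o\<^sub>L U)" and UV: "U o\<^sub>L V = id_blinfun"
  shows "norm H \<le> norm L"
proof -
  have "norm H ^ (2 ^ k) \<le> (norm V * norm U) * norm L ^ (2 ^ k)" for k
    using assms(1,2)
  proof (induction k arbitrary: H L)
    case 0
    have "norm H \<le> norm V * norm (L o\<^sub>L U)"
      unfolding 0(2) by (rule norm_blinfun_compose)
    also have "\<dots> \<le> norm V * (norm L * norm U)"
      by (intro mult_left_mono norm_blinfun_compose) simp
    finally show ?case by (simp add: mult_ac)
  next
    case (Suc k)
    have "U (V x) = x" for x
      using arg_cong[OF UV, of "\<lambda>W. W x"] by simp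
    then have HH: "H o\<^sub>L H = V o\<^sub>L ((L o\<^sub>L L) o\<^sub>L U)"
      unfolding Suc(3) by (intro blinfun_eqI) simp
    have "norm H ^ (2 ^ Suc k) = ((norm H)\<^sup>2) ^ (2 ^ k)"
      by (simp add: power_mult)
    also have "\<dots> \<le> norm (H o\<^sub>L H) ^ (2 ^ k)"
      by (intro power_mono norm_sq_le_norm_adjoint_compose Suc(2)) simp
    also have "\<dots> \<le> (norm V * norm U) * norm (L o\<^sub>L L) ^ (2 ^ k)"
      by (intro Suc.IH is_adjoint_compose Suc(2) HH)
    also have "\<dots> \<le> (norm V * norm U) * ((norm L)\<^sup>2) ^ (2 ^ k)"
      unfolding power2_eq_square
      by (intro mult_left_mono power_mono norm_blinfun_compose) simp_all
    also have "\<dots> = (norm V * norm U) * norm L ^ (2 ^ Suc k)"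
      by (simp add: power_mult)
    finally show ?case .
  qed
  then show ?thesis
    by (rule le_if_power_two_power_le[rotated 2]) simp_all
qed

lemma is_adjoint_inverse:
  fixes R S :: "'a::real_inner \<Rightarrow>\<^sub>L 'a"
  assumes "is_adjoint R R" and RS: "\<And>x. R (S x) = x"
  shows "is_adjoint S S"
  unfolding is_adjoint_def
proof (intro allI)
  fix x y
  have "inner (S x) y = inner (S x) (R (S y))"
    by (simp add: RS)
  also have "\<dots> = inner x (S y)"
    using is_adjointD[OF assms(1), of "S x" "S y"] by (simp add: RS)
  finally show "inner (S x) y = inner x (S y)" .
qed

text \<open>
  For \<open>X = R Y R\<^sup>-\<^sup>1\<close> the operator \<open>X\<^sup>* X = R\<^sup>-\<^sup>1 Y\<^sup>* R\<^sup>2 Y R\<^sup>-\<^sup>1\<close> is symmetric and similar to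
  \<open>Y\<^sup>* (R\<^sup>2 Y R\<^sup>-\<^sup>2)\<close>.
\<close>

lemma norm_similar_sq_le:
  fixes R S Y Y' :: "'a::real_inner \<Rightarrow>\<^sub>L 'a"
  assumes R: "is_adjoint R R" and RS: "\<And>x. R (S x) = x" and SR: "\<And>x. S (R x) = x"
    and adj: "is_adjoint Y Y'"
  shows "(norm (R o\<^sub>L Y o\<^sub>L S))\<^sup>2 \<le> norm Y * norm ((R o\<^sub>L R) o\<^sub>L Y o\<^sub>L (S o\<^sub>L S))"
proof -
  define X where "X = R o\<^sub>L Y o\<^sub>L S"
  define X' where "X' = S o\<^sub>L (Y' o\<^sub>L R)"
  define Z where "Z = (R o\<^sub>L R) o\<^sub>L Y o\<^sub>L (S o\<^sub>L S)"
  have S: "is_adjoint S S"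
    using R RS by (rule is_adjoint_inverse)
  have X: "is_adjoint X X'"
    unfolding X_def X'_def by (intro is_adjoint_compose R S adj)
  have "(norm X)\<^sup>2 \<le> norm (X' o\<^sub>L X)"
    by (rule norm_sq_le_norm_adjoint_compose[OF X])
  also have "\<dots> \<le> norm (Y' o\<^sub>L Z)"
  proof (rule norm_symmetric_similar_le)
    show "is_adjoint (X' o\<^sub>L X) (X' o\<^sub>L X)"
      by (intro is_adjoint_compose X is_adjoint_sym[OF X])
    show "X' o\<^sub>L X = S o\<^sub>L ((Y' o\<^sub>L Z) o\<^sub>L R)"
      by (rule blinfun_eqI) (simp add: X_def X'_def Z_def SR)
    show "R o\<^sub>L S = id_blinfun"
      by (rule blinfun_eqI) (simp add: RS)
  qed
  also have "\<dots> \<le> norm Y' * norm Z"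
    by (rule norm_blinfun_compose)
  also have "\<dots> \<le> norm Y * norm Z"
    by (intro mult_right_mono norm_adjoint_le[OF adj]) simp
  finally show ?thesis
    by (simp add: X_def Z_def)
qed

text \<open>
  By \<open>norm_similar_sq_le\<close>, \<open>a\<^sub>k = \<parallel>R\<^sup>m Y R\<^sup>-\<^sup>m\<parallel>\<close> with \<open>m = 2\<^sup>k\<close> satisfies \<open>a\<^sub>k\<^sup>2 \<le> \<parallel>Y\<parallel> a\<^sub>k\<^sub>+\<^sub>1\<close>. As all
  \<open>a\<^sub>k\<close> are at most \<open>C\<close>, this iterates to \<open>a\<^sub>0\<^sup>m \<parallel>Y\<parallel> \<le> C \<parallel>Y\<parallel>\<^sup>m\<close>. The bound on powers is stated with
  iterates of the function \<open>R\<close>, so that it passes directly from \<open>R\<close> to \<open>R\<^sup>2\<close>.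
\<close>

lemma norm_similar_le:
  fixes R S Y Y' :: "'a::real_inner \<Rightarrow>\<^sub>L 'a"
  assumes "is_adjoint R R" and "\<And>x. R (S x) = x" and "\<And>x. S (R x) = x"
    and adj: "is_adjoint Y Y'"
    and "\<And>n x. norm ((blinfun_apply R ^^ n) (Y x)) \<le> C * norm ((blinfun_apply R ^^ n) x)"
    and "0 \<le> C"
  shows "norm (R o\<^sub>L Y o\<^sub>L S) \<le> norm Y"
proof (cases "norm Y = 0")
  case True
  then have "Y = 0" by simp
  then have "R o\<^sub>L Y o\<^sub>L S = 0"
    by (intro blinfun_eqI) (simp add: blinfun.zero_left blinfun.zero_right)
  then show ?thesis by simp
next
  case False
  have "norm (R o\<^sub>L Y o\<^sub>L S) ^ (2 ^ k) * norm Y \<le> C * norm Y ^ (2 ^ k)" for k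
    using assms(1,2,3,5)
  proof (induction k arbitrary: R S)
    case 0
    have "norm (R o\<^sub>L Y o\<^sub>L S) \<le> C"
    proof (rule norm_blinfun_bound[OF \<open>0 \<le> C\<close>])
      show "norm ((R o\<^sub>L Y o\<^sub>L S) x) \<le> C * norm x" for x
        using 0(4)[of 1 "S x"] by (simp add: 0(2))
    qed
    then show ?case
      by (simp add: mult_right_mono)
  next
    case (Suc k)
    let ?a = "norm (R o\<^sub>L Y o\<^sub>L S)"
    let ?b = "norm ((R o\<^sub>L R) o\<^sub>L Y o\<^sub>L (S o\<^sub>L S))"
    have "?a ^ (2 ^ Suc k) * norm Y = (?a\<^sup>2) ^ (2 ^ k) * norm Y"
      by (simp add: power_mult)
    also have "\<dots> \<le> (norm Y * ?b) ^ (2 ^ k) * norm Y"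
      by (intro mult_right_mono power_mono norm_similar_sq_le[OF Suc(2,3,4) adj]) simp_all
    also have "\<dots> = norm Y ^ (2 ^ k) * (?b ^ (2 ^ k) * norm Y)"
      by (simp add: power_mult_distrib)
    also have "\<dots> \<le> norm Y ^ (2 ^ k) * (C * norm Y ^ (2 ^ k))"
    proof (intro mult_left_mono Suc.IH)
      show "is_adjoint (R o\<^sub>L R) (R o\<^sub>L R)"
        by (intro is_adjoint_compose Suc(2))
      show "(R o\<^sub>L R) ((S o\<^sub>L S) x) = x" "(S o\<^sub>L S) ((R o\<^sub>L R) x) = x" for x
        by (simp_all add: Suc(3,4))
      have "blinfun_apply (R o\<^sub>L R) = blinfun_apply R ^^ 2"
        by (rule ext) (simp add: numeral_2_eq_2)
      then have "blinfun_apply (R o\<^sub>L R) ^^ n = blinfun_apply R ^^ (2 * n)" for n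
        by (simp add: funpow_mult mult.commute)
      then show "norm ((blinfun_apply (R o\<^sub>L R) ^^ n) (Y x))
          \<le> C * norm ((blinfun_apply (R o\<^sub>L R) ^^ n) x)" for n x
        by (simp add: Suc(5))
    qed simp
    also have "\<dots> = C * (norm Y ^ (2 ^ k) * norm Y ^ (2 ^ k))"
      by simp
    also have "norm Y ^ (2 ^ k) * norm Y ^ (2 ^ k) = norm Y ^ (2 ^ Suc k)"
      by (simp flip: power_add add: mult_2)
    finally show ?case .
  qed
  then have "norm (R o\<^sub>L Y o\<^sub>L S) ^ (2 ^ k) \<le> (C / norm Y) * norm Y ^ (2 ^ k)" for k
    using False by (simp add: field_simps)
  then show ?thesis
    by (rule le_if_power_two_power_le[rotated 2]) simp_all
qed

section \<open>Self-adjoint operators with bounded conjugates\<close>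


lemma funpow_apply_commute:
  assumes "\<And>x. f (g x) = g (f x)"
  shows "(f ^^ n) (g x) = g ((f ^^ n) x)"
  by (induction n) (simp_all add: assms)

lemma scaleC_i_scaleR: "\<i> *\<^sub>C r *\<^sub>R x = r *\<^sub>R \<i> *\<^sub>C (x::'a::complex_hilbert_space)"
  by (simp add: scaleR_scaleC scaleC_scaleC mult.commute)

lemma norm_add_scaleR_i_sq:
  fixes x y :: "'a::complex_hilbert_space"
  shows "(norm (x + t *\<^sub>R \<i> *\<^sub>C y))\<^sup>2
    = (norm x)\<^sup>2 + 2 * t * inner x (\<i> *\<^sub>C y) + t\<^sup>2 * (norm y)\<^sup>2"
  unfolding power2_norm_eq_inner
  by (simp add: inner_add inner_scaleC_i inner_commute power2_eq_square)

text \<open>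
  The operators \<open>A + \<i> t\<close> satisfy the same kind of bound as \<open>A\<close>, so \<open>\<parallel>R (A + \<i> t) R\<^sup>-\<^sup>1\<parallel>\<^sup>2 \<le> \<parallel>A\<parallel>\<^sup>2 + t\<^sup>2\<close>.
  For \<open>X = R A R\<^sup>-\<^sup>1\<close> the left side evaluated at \<open>x\<close> contains the term \<open>2 t \<langle>X x, \<i> x\<rangle>\<close>, linear in \<open>t\<close>,
  and the \<open>t\<^sup>2\<close> terms cancel; so that term must vanish.
\<close>

lemma similar_symmetric:
  fixes A R S :: "'a::complex_hilbert_space \<Rightarrow>\<^sub>L 'a"
  assumes A: "A \<in> bounded_ops" "is_adjoint A A"
    and R: "R \<in> bounded_ops" "is_adjoint R R"
    and RS: "\<And>x. R (S x) = x" and SR: "\<And>x. S (R x) = x"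
    and bound: "\<And>n x. norm ((blinfun_apply R ^^ n) (A x)) \<le> C * norm ((blinfun_apply R ^^ n) x)"
    and C: "0 \<le> C"
  shows "is_adjoint (R o\<^sub>L A o\<^sub>L S) (R o\<^sub>L A o\<^sub>L S)"
proof -
  define X where "X = R o\<^sub>L A o\<^sub>L S"
  have Ai: "A (\<i> *\<^sub>C x) = \<i> *\<^sub>C A x" and Ri: "R (\<i> *\<^sub>C x) = \<i> *\<^sub>C R x" for x
    using A(1) R(1) by (simp_all add: bounded_ops_def)
  have Si: "S (\<i> *\<^sub>C x) = \<i> *\<^sub>C S x" for x
    by (metis RS SR Ri)
  have X: "X \<in> bounded_ops"
    unfolding bounded_ops_iff by (rule commuteI) (simp add: X_def Ai Ri Si)
  have key: "(norm (X x + t *\<^sub>R \<i> *\<^sub>C x))\<^sup>2 \<le> ((norm A)\<^sup>2 + t\<^sup>2) * (norm x)\<^sup>2" for t x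
  proof -
    define Y where "Y = A + t *\<^sub>R i_op"
    define Y' where "Y' = A - t *\<^sub>R i_op"
    have Y: "Y x = A x + t *\<^sub>R \<i> *\<^sub>C x" and Y': "Y' x = A x - t *\<^sub>R \<i> *\<^sub>C x" for x
      by (simp_all add: Y_def Y'_def blinfun.bilinear_simps)
    have normY: "norm Y \<le> sqrt ((norm A)\<^sup>2 + t\<^sup>2)"
    proof (rule norm_blinfun_bound)
      fix x
      have "(norm (Y x))\<^sup>2 = (norm (A x))\<^sup>2 + t\<^sup>2 * (norm x)\<^sup>2"
        using A(2) symmetric_iff[OF A(1)] by (simp add: Y norm_add_scaleR_i_sq)
      also have "\<dots> \<le> (norm A * norm x)\<^sup>2 + t\<^sup>2 * (norm x)\<^sup>2"
        by (intro add_right_mono power_mono norm_blinfun) simp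
      also have "\<dots> = (sqrt ((norm A)\<^sup>2 + t\<^sup>2) * norm x)\<^sup>2"
        by (simp add: power_mult_distrib distrib_right)
      finally show "norm (Y x) \<le> sqrt ((norm A)\<^sup>2 + t\<^sup>2) * norm x"
        by (rule power2_le_imp_le) simp
    qed simp
    have "norm (R o\<^sub>L Y o\<^sub>L S) \<le> norm Y"
    proof (rule norm_similar_le)
      show "is_adjoint Y Y'"
        by (simp add: is_adjoint_def Y Y' inner_add inner_diff is_adjointD[OF A(2)] inner_i_op_left)
      fix n x
      let ?Rn = "blinfun_apply R ^^ n"
      have add: "?Rn (x + y) = ?Rn x + ?Rn y" for x y
        by (induction n arbitrary: x y) (simp_all add: blinfun.add_right)
      have "?Rn (Y x) = ?Rn (A x) + t *\<^sub>R \<i> *\<^sub>C ?Rn x"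
        unfolding Y add
        using funpow_apply_commute[of R "\<lambda>x. t *\<^sub>R \<i> *\<^sub>C x" n x]
        by (simp add: blinfun.scaleR_right Ri)
      then have "norm (?Rn (Y x)) \<le> norm (?Rn (A x)) + \<bar>t\<bar> * norm (?Rn x)"
        using norm_triangle_ineq[of "?Rn (A x)" "t *\<^sub>R \<i> *\<^sub>C ?Rn x"]
        by (simp add: norm_scaleC_i)
      then show "norm (?Rn (Y x)) \<le> (C + \<bar>t\<bar>) * norm (?Rn x)"
        using bound[of n x] by (simp add: distrib_right)
    qed (use R RS SR C in auto)
    with normY have le: "norm (R o\<^sub>L Y o\<^sub>L S) \<le> sqrt ((norm A)\<^sup>2 + t\<^sup>2)"
      by simp
    have "X x + t *\<^sub>R \<i> *\<^sub>C x = (R o\<^sub>L Y o\<^sub>L S) x"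
      by (simp add: X_def Y blinfun.add_right blinfun.scaleR_right Ri RS)
    then have "norm (X x + t *\<^sub>R \<i> *\<^sub>C x) \<le> norm (R o\<^sub>L Y o\<^sub>L S) * norm x"
      by (simp only: norm_blinfun)
    also have "\<dots> \<le> sqrt ((norm A)\<^sup>2 + t\<^sup>2) * norm x"
      by (rule mult_right_mono[OF le norm_ge_zero])
    finally have "(norm (X x + t *\<^sub>R \<i> *\<^sub>C x))\<^sup>2 \<le> (sqrt ((norm A)\<^sup>2 + t\<^sup>2) * norm x)\<^sup>2"
      by (intro power_mono) simp_all
    then show ?thesis
      by (simp add: power_mult_distrib)
  qed
  have "inner (X x) (\<i> *\<^sub>C x) = 0" for x
  proof (rule ccontr)
    define s where "s = inner (X x) (\<i> *\<^sub>C x)"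
    define c where "c = (norm A)\<^sup>2 * (norm x)\<^sup>2"
    assume "inner (X x) (\<i> *\<^sub>C x) \<noteq> 0"
    then have s: "s \<noteq> 0" by (simp add: s_def)
    \<comment> \<open>\<open>key\<close> gives \<open>2 t s \<le> c\<close> for all real \<open>t\<close>; this \<open>t\<close> makes the left side \<open>c + 1\<close>.\<close>
    have "2 * ((c + 1) / (2 * s)) * s \<le> c"
      using key[of x "(c + 1) / (2 * s)"] zero_le_power2[of "norm (X x)"]
      unfolding norm_add_scaleR_i_sq s_def[symmetric] distrib_right c_def[symmetric]
      by linarith
    with s show False by simp
  qed
  then show ?thesis
    using symmetric_iff[OF X] by (simp add: X_def)
qed

text \<open>
  Symmetry of \<open>R A R\<^sup>-\<^sup>1\<close> means \<open>R A R\<^sup>-\<^sup>1 = R\<^sup>-\<^sup>1 A R\<close>; multiply by \<open>R\<close> on both sides.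
\<close>

lemma commute_square_if_powers_bounded:
  fixes A R S :: "'a::complex_hilbert_space \<Rightarrow>\<^sub>L 'a"
  assumes A: "A \<in> bounded_ops" "is_adjoint A A"
    and R: "R \<in> bounded_ops" "is_adjoint R R"
    and RS: "\<And>x. R (S x) = x" and SR: "\<And>x. S (R x) = x"
    and bound: "\<And>n x. norm ((blinfun_apply R ^^ n) (A x)) \<le> C * norm ((blinfun_apply R ^^ n) x)"
    and C: "0 \<le> C"
  shows "commute (R o\<^sub>L R) A"
proof (rule commuteI)
  fix x
  have "is_adjoint S S"
    using R(2) RS by (rule is_adjoint_inverse)
  then have "is_adjoint (R o\<^sub>L A o\<^sub>L S) (S o\<^sub>L (A o\<^sub>L R))"
    using A(2) R(2) by (intro is_adjoint_compose)
  then have "R o\<^sub>L A o\<^sub>L S = S o\<^sub>L (A o\<^sub>L R)"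
    using similar_symmetric[OF assms] is_adjoint_unique by blast
  then have "R (A (S (R x))) = S (A (R (R x)))"
    by (metis blinfun_apply_blinfun_compose)
  then show "(R o\<^sub>L R) (A x) = A ((R o\<^sub>L R) x)"
    by (simp add: SR RS)
qed

section \<open>Self-adjoint intertwiners of a normal operator and its adjoint\<close>

text \<open>
  A right and a left inverse of \<open>1 + Q\<close> are the fixed points of the contractions \<open>X \<mapsto> 1 - Q X\<close> and
  \<open>X \<mapsto> 1 - X Q\<close>; two one-sided inverses coincide.
\<close>

lemma id_plus_contraction_inverse:
  fixes Q :: "'a::banach \<Rightarrow>\<^sub>L 'a"
  assumes "norm Q < 1"
  obtains S :: "'a \<Rightarrow>\<^sub>L 'a" where "\<And>x. S x + Q (S x) = x" and "\<And>x. S (x + Q x) = x"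
proof -
  have contr: "dist (id_blinfun - (Q o\<^sub>L X)) (id_blinfun - (Q o\<^sub>L Y)) \<le> norm Q * dist X Y"
    "dist (id_blinfun - (X o\<^sub>L Q)) (id_blinfun - (Y o\<^sub>L Q)) \<le> norm Q * dist X Y" for X Y
  proof -
    have "(id_blinfun - (Q o\<^sub>L X)) - (id_blinfun - (Q o\<^sub>L Y)) = Q o\<^sub>L (Y - X)"
      "(id_blinfun - (X o\<^sub>L Q)) - (id_blinfun - (Y o\<^sub>L Q)) = (Y - X) o\<^sub>L Q"
      by (auto intro!: blinfun_eqI simp: blinfun.bilinear_simps)
    then show "dist (id_blinfun - (Q o\<^sub>L X)) (id_blinfun - (Q o\<^sub>L Y)) \<le> norm Q * dist X Y"
      "dist (id_blinfun - (X o\<^sub>L Q)) (id_blinfun - (Y o\<^sub>L Q)) \<le> norm Q * dist X Y"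
      using norm_blinfun_compose[of Q "Y - X"] norm_blinfun_compose[of "Y - X" Q]
      by (simp_all add: dist_norm norm_minus_commute mult.commute)
  qed
  obtain S where S: "id_blinfun - (Q o\<^sub>L S) = S"
    using banach_fix_type[of "norm Q" "\<lambda>X. id_blinfun - (Q o\<^sub>L X)"] assms contr by auto
  obtain S' where S': "id_blinfun - (S' o\<^sub>L Q) = S'"
    using banach_fix_type[of "norm Q" "\<lambda>X. id_blinfun - (X o\<^sub>L Q)"] assms contr by auto
  have right: "S x + Q (S x) = x" for x
  proof -
    have "x - Q (S x) = S x"
      using arg_cong[OF S, of "\<lambda>U. U x"] by (simp add: blinfun.diff_left)
    then show ?thesis by (simp add: algebra_simps)
  qed
  have left: "S' (x + Q x) = x" for x
  proof -
    have "x - S' (Q x) = S' x"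
      using arg_cong[OF S', of "\<lambda>U. U x"] by (simp add: blinfun.diff_left)
    then show ?thesis by (simp add: blinfun.add_right algebra_simps)
  qed
  have "S' = S"
    by (rule blinfun_eqI) (metis left right)
  with left right show thesis
    using that by blast
qed

lemma inner_funpow:
  fixes R :: "'a::real_inner \<Rightarrow>\<^sub>L 'a"
  assumes "is_adjoint R R"
  shows "inner ((blinfun_apply R ^^ n) x) y = inner x ((blinfun_apply R ^^ n) y)"
  by (induction n arbitrary: x y)
    (simp_all add: is_adjointD[OF assms] funpow_swap1)

lemma norm_normal_apply:
  fixes N M :: "'a::real_inner \<Rightarrow>\<^sub>L 'a"
  assumes "is_adjoint N M" and "commute N M"
  shows "norm (M x) = norm (N x)"
proof -
  have "inner (N x) (N x) = inner (M x) (M x)"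
    using is_adjointD[OF assms(1), of x "N x"] is_adjointD[OF is_adjoint_sym[OF assms(1)], of x "M x"]
    by (simp add: commuteD[OF assms(2)])
  then show ?thesis
    by (simp add: norm_eq_sqrt_inner)
qed

lemma norm_normal_funpow:
  fixes N M :: "'a::real_inner \<Rightarrow>\<^sub>L 'a"
  assumes "is_adjoint N M" and "commute N M"
  shows "norm ((blinfun_apply M ^^ k) x) = norm ((blinfun_apply N ^^ k) x)"
proof (induction k arbitrary: x)
  case 0
  show ?case by simp
next
  case (Suc k)
  have "norm ((blinfun_apply M ^^ Suc k) x) = norm ((blinfun_apply N ^^ k) (M x))"
    by (simp add: Suc funpow_Suc_right del: funpow.simps)
  also have "(blinfun_apply N ^^ k) (M x) = M ((blinfun_apply N ^^ k) x)"
    by (rule funpow_apply_commute) (rule commuteD[OF assms(2)])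
  also have "norm \<dots> = norm ((blinfun_apply N ^^ Suc k) x)"
    by (simp add: norm_normal_apply[OF assms])
  finally show ?case .
qed

text \<open>
  Since \<open>N\<^sup>k A = A M\<^sup>k\<close> and \<open>\<parallel>M\<^sup>k x\<parallel> = \<parallel>N\<^sup>k x\<parallel>\<close>, one has \<open>\<parallel>N\<^sup>k A x\<parallel> \<le> \<parallel>A\<parallel> \<parallel>N\<^sup>k x\<parallel>\<close>.
  The form \<open>F m z = \<langle>R\<^sup>m z, z\<rangle>\<close> satisfies \<open>F (m + 1) z = F m z + e F m (N z)\<close>, so it is a nonnegative
  combination of the \<open>\<parallel>N\<^sup>k z\<parallel>\<^sup>2\<close>, and the estimate carries over to it, in
  particular to \<open>F (2 n) z = \<parallel>R\<^sup>n z\<parallel>\<^sup>2\<close>.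
\<close>

lemma intertwiner_powers_bounded:
  fixes A N M R :: "'a::real_inner \<Rightarrow>\<^sub>L 'a"
  assumes adj: "is_adjoint N M" and normal: "commute N M"
    and NA: "\<And>x. N (A x) = A (M x)"
    and R: "\<And>x. R x = x + e *\<^sub>R M (N x)" and "0 \<le> e"
  shows "norm ((blinfun_apply R ^^ n) (A x)) \<le> norm A * norm ((blinfun_apply R ^^ n) x)"
proof -
  have symR: "is_adjoint R R"
    by (simp add: is_adjoint_def R inner_add is_adjointD[OF adj]
        is_adjointD[OF is_adjoint_sym[OF adj]])
  define F where "F m z = inner ((blinfun_apply R ^^ m) z) z" for m z
  have F_Suc: "F (Suc m) z = F m z + e * F m (N z)" for m z
  proof -
    have "R (N y) = N (R y)" for y
      by (simp add: R blinfun.add_right blinfun.scaleR_right commuteD[OF normal])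
    then have "(blinfun_apply R ^^ m) (N z) = N ((blinfun_apply R ^^ m) z)"
      by (rule funpow_apply_commute)
    then show ?thesis
      by (simp add: F_def R inner_add is_adjointD[OF is_adjoint_sym[OF adj]])
  qed
  have N_pow: "norm ((blinfun_apply N ^^ k) (A x)) \<le> norm A * norm ((blinfun_apply N ^^ k) x)" for k
  proof -
    have "(blinfun_apply N ^^ k) (A x) = A ((blinfun_apply M ^^ k) x)"
      by (induction k) (simp_all add: NA)
    then show ?thesis
      using norm_blinfun[of A "(blinfun_apply M ^^ k) x"]
      by (simp add: norm_normal_funpow[OF adj normal])
  qed
  have F_le: "F m ((blinfun_apply N ^^ k) (A x)) \<le> (norm A)\<^sup>2 * F m ((blinfun_apply N ^^ k) x)" for m k
  proof (induction m arbitrary: k)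
    case 0
    show ?case
      using power_mono[OF N_pow[of k], of 2]
      by (simp add: F_def power_mult_distrib flip: power2_norm_eq_inner)
  next
    case (Suc m)
    have "e * F m ((blinfun_apply N ^^ Suc k) (A x))
        \<le> e * ((norm A)\<^sup>2 * F m ((blinfun_apply N ^^ Suc k) x))"
      by (intro mult_left_mono Suc.IH \<open>0 \<le> e\<close>)
    with Suc.IH[of k] show ?case
      by (simp add: F_Suc algebra_simps)
  qed
  have norm_R: "(norm ((blinfun_apply R ^^ n) z))\<^sup>2 = F (n + n) z" for z
    by (simp add: F_def power2_norm_eq_inner funpow_add inner_funpow[OF symR])
  have "(norm ((blinfun_apply R ^^ n) (A x)))\<^sup>2 \<le> (norm A * norm ((blinfun_apply R ^^ n) x))\<^sup>2"
    using F_le[of "n + n" 0] by (simp add: norm_R power_mult_distrib)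
  then show ?thesis
    by (rule power2_le_imp_le) simp
qed

text \<open>
  \<open>R = 1 + e M N\<close> is symmetric and positive, and the choice of \<open>e\<close> makes it invertible. So \<open>A\<close>
  commutes with \<open>R\<^sup>2\<close>, and therefore with its positive root \<open>R\<close>.
\<close>

lemma intertwiner_commutes_modulus_square:
  fixes A N M :: "'a::complex_hilbert_space \<Rightarrow>\<^sub>L 'a"
  assumes A: "A \<in> bounded_ops" "is_adjoint A A"
    and N: "N \<in> bounded_ops" "M \<in> bounded_ops" "is_adjoint N M" "commute N M"
    and NA: "\<And>x. N (A x) = A (M x)"
  shows "commute (M o\<^sub>L N) A"
proof -
  define e where "e = 1 / (1 + norm (M o\<^sub>L N))"
  have e: "0 < e" by (simp add: e_def add_pos_nonneg)
  define Q where "Q = e *\<^sub>R (M o\<^sub>L N)"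
  define R where "R = id_blinfun + Q"
  have R: "R x = x + e *\<^sub>R M (N x)" for x
    by (simp add: R_def Q_def blinfun.add_left blinfun.scaleR_left)
  have "norm Q < 1"
    by (simp add: Q_def e_def add_pos_nonneg)
  then obtain S :: "'a \<Rightarrow>\<^sub>L 'a" where S: "\<And>x. S x + Q (S x) = x" "\<And>x. S (x + Q x) = x"
    using id_plus_contraction_inverse by blast
  have RQ: "R x = x + Q x" for x
    by (simp add: R_def blinfun.add_left)
  have symR: "is_adjoint R R"
    by (simp add: is_adjoint_def R inner_add is_adjointD[OF N(3)]
        is_adjointD[OF is_adjoint_sym[OF N(3)]])
  have posR: "0 \<le> inner (R x) x" for x
    using e by (simp add: R inner_add is_adjointD[OF is_adjoint_sym[OF N(3)]])
  have opR: "R \<in> bounded_ops"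
    using commuteD[OF N(1)[unfolded bounded_ops_iff]] commuteD[OF N(2)[unfolded bounded_ops_iff]]
    unfolding bounded_ops_iff by (intro commuteI) (simp add: R scaleC_add_right scaleC_i_scaleR)
  have "commute (R o\<^sub>L R) A"
  proof (rule commute_square_if_powers_bounded[OF A opR symR, where S = S and C = "norm A"])
    show "R (S x) = x" "S (R x) = x" for x
      by (simp_all add: RQ S)
    show "norm ((blinfun_apply R ^^ n) (A x)) \<le> norm A * norm ((blinfun_apply R ^^ n) x)" for n x
      using e by (intro intertwiner_powers_bounded[OF N(3,4) NA R]) simp
  qed simp
  then have "commute R A"
    by (rule commute_positive_root[OF symR posR])
  from commuteD[OF this] show ?thesis
    using e by (intro commuteI) (simp add: R blinfun.add_right blinfun.scaleR_right)
qed

text \<open>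
  The Fuglede--Putnam theorem for a self-adjoint intertwiner. For \<open>D = M A - A N\<close>, commutation of
  \<open>A\<close> with \<open>M N\<close> gives \<open>N D = 0\<close>, so \<open>D\<close> maps into the common kernel of \<open>N\<close> and \<open>M\<close>. The operator
  \<open>A\<close> preserves this kernel, hence \<open>D\<close> vanishes on it and \<open>D\<^sup>2 = 0\<close>. As \<open>D\<close> is skew-adjoint,
  \<open>\<parallel>D x\<parallel>\<^sup>2 = - \<langle>x, D\<^sup>2 x\<rangle> = 0\<close>.
\<close>

lemma intertwiner_adjoint:
  fixes A N M :: "'a::complex_hilbert_space \<Rightarrow>\<^sub>L 'a"
  assumes A: "A \<in> bounded_ops" "is_adjoint A A"
    and N: "N \<in> bounded_ops" "M \<in> bounded_ops" "is_adjoint N M" "commute N M"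
    and NA: "\<And>x. N (A x) = A (M x)"
  shows "M (A x) = A (N x)"
proof -
  define D where "D x = M (A x) - A (N x)" for x
  have MN: "M (N (A x)) = A (M (N x))" for x
    using commuteD[OF intertwiner_commutes_modulus_square[OF assms], of x] by simp
  have ND: "N (D x) = 0" for x
    using trans[OF commuteD[OF N(4)] MN, of x] by (simp add: D_def blinfun.diff_right NA)
  have M0: "M y = 0" if "N y = 0" for y
    using norm_normal_apply[OF N(3,4), of y] that by simp
  have DD: "D (D x) = 0" for x
  proof -
    have "N (A (D x)) = 0"
      by (simp add: NA M0 ND)
    then show ?thesis
      by (simp add: D_def[of "D x"] M0 ND)
  qed
  have "inner (D x) y = - inner x (D y)" for x y
    by (simp add: D_def inner_diff is_adjointD[OF A(2)] is_adjointD[OF N(3)]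
        is_adjointD[OF is_adjoint_sym[OF N(3)]])
  then have "inner (D x) (D x) = 0"
    by (simp add: DD)
  then show ?thesis
    by (simp add: D_def)
qed

section \<open>The modulus of a product\<close>

text \<open>
  Since \<open>|A|\<^sup>2 = A\<^sup>2\<close>, the modulus is determined by \<open>A\<^sup>2\<close> and inherits its commutation relations.
\<close>

lemma abs_op_selfadjoint:
  fixes A :: "'a::complex_hilbert_space \<Rightarrow>\<^sub>L 'a"
  assumes "A \<in> bounded_ops" and "selfadjoint_op A"
  shows "positive_op (abs_op A)" and "abs_op A o\<^sub>L abs_op A = A o\<^sub>L A"
    and "commute (A o\<^sub>L A) T \<Longrightarrow> commute (abs_op A) T"
proof -
  have sym: "is_adjoint A A"
    using assms by (rule selfadjoint_op_is_adjoint)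
  have pos: "0 \<le> inner ((A o\<^sub>L A) x) x" for x
    using inner_ge_zero[of "A x"] is_adjointD[OF sym, of "A x" x] by simp
  obtain S where S: "is_adjoint S S" "\<And>x. 0 \<le> inner (S x) x" "S o\<^sub>L S = A o\<^sub>L A"
    "\<And>T. commute (A o\<^sub>L A) T \<Longrightarrow> commute S T"
    using positive_root_exists[OF is_adjoint_compose[OF sym sym] pos] by blast
  have "commute (A o\<^sub>L A) i_op"
    using commuteD[OF assms(1)[unfolded bounded_ops_iff]] by (intro commuteI) simp
  then have "positive_op S"
    using S by (simp add: positive_op_iff bounded_ops_iff)
  moreover have "abs_op A = S"
    using sqrt_op_eqI[OF \<open>positive_op S\<close> S(3)] assms(2)
    by (simp add: abs_op_def selfadjoint_op_def)
  ultimately show "positive_op (abs_op A)" "abs_op A o\<^sub>L abs_op A = A o\<^sub>L A"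
    "commute (A o\<^sub>L A) T \<Longrightarrow> commute (abs_op A) T"
    using S by auto
qed

theorem theorem2p2:
  fixes A B :: "'a::complex_hilbert_space \<Rightarrow>\<^sub>L 'a"
  assumes "A \<in> bounded_ops" and "B \<in> bounded_ops"
    and "selfadjoint_op A" and "selfadjoint_op B"
    and "normal_op (A o\<^sub>L B)"
  shows "abs_op (A o\<^sub>L B) = abs_op A o\<^sub>L abs_op B"
proof -
  have A: "is_adjoint A A" and B: "is_adjoint B B"
    using assms selfadjoint_op_is_adjoint by auto
  have AB: "A o\<^sub>L B \<in> bounded_ops" and BA: "B o\<^sub>L A \<in> bounded_ops"
    using assms(1,2) by (auto simp: bounded_ops_def)
  have adj: "is_adjoint (A o\<^sub>L B) (B o\<^sub>L A)"
    by (rule is_adjoint_compose[OF A B])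
  have adj_op: "adj_op (A o\<^sub>L B) = B o\<^sub>L A"
    by (rule adj_op_eqI[OF AB adj])
  have normal: "commute (A o\<^sub>L B) (B o\<^sub>L A)"
    using assms(5) by (simp add: normal_op_def commute_def adj_op)
  \<comment> \<open>\<open>N = AB\<close> is intertwined with its adjoint \<open>BA\<close> by \<open>A\<close>, and \<open>BA\<close> with \<open>AB\<close> by \<open>B\<close>.\<close>
  have BAA: "B (A (A x)) = A (A (B x))" for x
    using intertwiner_adjoint[OF assms(1) A AB BA adj normal, of x] by simp
  have ABB: "A (B (B x)) = B (B (A x))" for x
    using intertwiner_adjoint[OF assms(2) B BA AB is_adjoint_sym[OF adj] commute_sym[OF normal], of x]
    by simp
  define S T where "S = abs_op A" and "T = abs_op B"
  note S = abs_op_selfadjoint[OF assms(1,3), folded S_def]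
  note T = abs_op_selfadjoint[OF assms(2,4), folded T_def]
  have "commute (A o\<^sub>L A) B"
    by (rule commuteI) (simp add: BAA)
  then have SB: "commute S B"
    by (rule S(3))
  have "commute (B o\<^sub>L B) S"
    by (rule commuteI) (simp add: commuteD[OF SB])
  then have "commute T S"
    by (rule T(3))
  then have ST: "commute S T"
    by (rule commute_sym)
  have pos: "positive_op (S o\<^sub>L T)"
    unfolding positive_op_iff
  proof (intro conjI allI)
    show "S o\<^sub>L T \<in> bounded_ops"
      using S(1) T(1) by (simp add: positive_op_iff bounded_ops_def)
    have "is_adjoint (S o\<^sub>L T) (T o\<^sub>L S)"
      using S(1) T(1) by (intro is_adjoint_compose) (auto simp: positive_op_iff)
    then show "is_adjoint (S o\<^sub>L T) (S o\<^sub>L T)"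
      using ST by (simp add: commute_def)
    show "0 \<le> inner ((S o\<^sub>L T) x) x" for x
      using S(1) T(1) ST by (intro positive_compose_commuting) (auto simp: positive_op_iff)
  qed
  have "(S o\<^sub>L T) o\<^sub>L (S o\<^sub>L T) = adj_op (A o\<^sub>L B) o\<^sub>L (A o\<^sub>L B)"
  proof (rule blinfun_eqI)
    fix x
    have SS: "S (S y) = A (A y)" and TT: "T (T y) = B (B y)" for y
      using arg_cong[OF S(2), of "\<lambda>U. U y"] arg_cong[OF T(2), of "\<lambda>U. U y"] by auto
    have "((S o\<^sub>L T) o\<^sub>L (S o\<^sub>L T)) x = S (S (T (T x)))"
      by (simp add: commuteD[OF ST])
    also have "\<dots> = B (A (A (B x)))"
      by (simp add: SS TT BAA)
    finally show "((S o\<^sub>L T) o\<^sub>L (S o\<^sub>L T)) x = (adj_op (A o\<^sub>L B) o\<^sub>L (A o\<^sub>L B)) x"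
      by (simp add: adj_op)
  qed
  then have "abs_op (A o\<^sub>L B) = S o\<^sub>L T"
    unfolding abs_op_def by (rule sqrt_op_eqI[OF pos])
  then show ?thesis
    by (simp add: S_def T_def)
qed

end
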